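(* Let $A$ be a square complex matrix which satisfies Crouzeix's conjecture and suppose that $N$ is a normal matrix. Then $N\otimes A$ and $A\otimes N$ satisfy Crouzeix's conjecture.
   Context: All matrices are square with complex entries, and $\otimes$ denotes the tensor (Kronecker) product of matrices. $W(A)=\{\langle Ax,x\rangle:\langle x,x\rangle=1\}$ is the numerical range with respect to the Euclidean inner product, and $\|\cdot\|$ is the operator norm induced by the Euclidean norm. A matrix $A$ "satisfies Crouzeix's conjecture" if $\|p(A)\|\le 2\sup_{z\in W(A)}|p(z)|$ for every complex polynomial $p$. *)

theory Defs
  imports "HOL-Analysis.Analysis" "HOL-Computational_Algebra.Polynomial"
begin

definition cinner :: "complex ^ 'n \<Rightarrow> complex ^ 'n \<Rightarrow> complex" where
  "cinner x y = (\<Sum>i\<in>UNIV. x $ i * cnj (y $ i))"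

definition numerical_range :: "complex ^ 'n ^ 'n \<Rightarrow> complex set" where
  "numerical_range A = {cinner (A *v x) x | x. cinner x x = 1}"

definition conj_transpose :: "complex ^ 'n ^ 'm \<Rightarrow> complex ^ 'm ^ 'n" where
  "conj_transpose A = (\<chi> i j. cnj (A $ j $ i))"

definition normal_matrix :: "complex ^ 'n ^ 'n \<Rightarrow> bool" where
  "normal_matrix A \<longleftrightarrow> A ** conj_transpose A = conj_transpose A ** A"

(* The class operations * and ^ on type vec act componentwise, so neither power nor poly
   applied to a matrix is the intended operation; powers with respect to matrix
   multiplication have to be defined separately. *)
primrec matrix_power :: "complex ^ 'n ^ 'n \<Rightarrow> nat \<Rightarrow> complex ^ 'n ^ 'n" where
  "matrix_power A 0 = mat 1"
| "matrix_power A (Suc k) = A ** matrix_power A k"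

(* mat c is the scalar matrix c I, so mat c ** B is the scalar multiple c B. *)
definition poly_matrix :: "complex poly \<Rightarrow> complex ^ 'n ^ 'n \<Rightarrow> complex ^ 'n ^ 'n" where
  "poly_matrix p A = (\<Sum>k\<le>degree p. mat (coeff p k) ** matrix_power A k)"

(* norm on complex ^ 'n is the Euclidean norm, so onorm is the norm induced by it. *)
definition matrix_opnorm :: "complex ^ 'n ^ 'n \<Rightarrow> real" where
  "matrix_opnorm A = onorm (\<lambda>x. A *v x)"

(* The real-valued supremum is a genuine one: see numerical_range_nonempty and
   bdd_above_poly_numerical_range below. *)
definition satisfies_crouzeix :: "complex ^ 'n ^ 'n \<Rightarrow> bool" where
  "satisfies_crouzeix A \<longleftrightarrow>
     (\<forall>p :: complex poly.
        matrix_opnorm (poly_matrix p A) \<le> 2 * (SUP z\<in>numerical_range A. cmod (poly p z)))"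

(* Rows and columns are indexed by pairs; ordering the pairs lexicographically gives the usual
   block form, whose (i, j) block is A $ i $ j times B. *)
definition kronecker ::
  "complex ^ 'm ^ 'm \<Rightarrow> complex ^ 'n ^ 'n \<Rightarrow> complex ^ ('m \<times> 'n) ^ ('m \<times> 'n)"
  (infixl "\<otimes>\<^sub>K" 70) where
  "A \<otimes>\<^sub>K B = (\<chi> i j. A $ fst i $ fst j * B $ snd i $ snd j)"

lemma cinner_self: "cinner x x = of_real ((norm x)\<^sup>2)"
  unfolding cinner_def norm_vec_def L2_set_def
  by (simp add: sum_nonneg complex_norm_square del: of_real_power)

lemma numerical_range_eq_image:
  "numerical_range A = (\<lambda>x. cinner (A *v x) x) ` sphere 0 1"
proof -
  have "cinner x x = 1 \<longleftrightarrow> norm x = 1" for x :: "complex ^ 'a"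
    by (metis cinner_self norm_ge_zero of_real_eq_1_iff one_power2 power2_eq_imp_eq zero_le_one)
  then show ?thesis by (auto simp: numerical_range_def)
qed

lemma numerical_range_nonempty: "numerical_range A \<noteq> {}"
proof -
  have "axis undefined 1 \<in> sphere (0 :: complex ^ 'a) 1" by (simp add: norm_axis_1)
  then show ?thesis unfolding numerical_range_eq_image by blast
qed

lemma compact_numerical_range: "compact (numerical_range A)"
  unfolding numerical_range_eq_image cinner_def matrix_vector_mult_def
  by (intro compact_continuous_image continuous_intros compact_sphere)

lemma bdd_above_poly_numerical_range:
  "bdd_above ((\<lambda>z. cmod (poly p z)) ` numerical_range A)"
  by (intro bounded_imp_bdd_above compact_imp_bounded compact_continuous_image
      continuous_intros compact_numerical_range)

end

theory Submission
  imports Defs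
    "HOL-Computational_Algebra.Fundamental_Theorem_Algebra"
begin

text \<open>
  If \<open>u\<close> runs through an orthonormal basis of eigenvectors of \<open>N\<close> with eigenvalues \<open>\<lambda> u\<close>, the maps
  \<open>y \<mapsto> u \<otimes> y\<close> embed \<open>\<complex>\<^sup>n\<close> isometrically onto mutually orthogonal subspaces on which \<open>N \<otimes> A\<close> acts
  as \<open>\<lambda> u A\<close>; so \<open>N \<otimes> A\<close> is an orthogonal direct sum of scalar multiples of \<open>A\<close>. Each summand
  satisfies \<open>p(\<lambda> A) = q(A)\<close> with \<open>q(z) = p(\<lambda> z)\<close>, and \<open>\<lambda> W(A) \<subseteq> W(N \<otimes> A)\<close>, so the bound for \<open>A\<close> applies
  to every summand. The maps \<open>y \<mapsto> y \<otimes> u\<close> do the same for \<open>A \<otimes> N\<close>.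
\<close>

section \<open>Sesquilinear algebra of \<open>cinner\<close> and adjoints\<close>

lemma cinner_add_left: "cinner (x + y) z = cinner x z + cinner y z"
  by (simp add: cinner_def distrib_right sum.distrib)

lemma cinner_diff_left: "cinner (x - y) z = cinner x z - cinner y z"
  by (simp add: cinner_def left_diff_distrib sum_subtractf)

lemma cinner_diff_right: "cinner x (y - z) = cinner x y - cinner x z"
  by (simp add: cinner_def right_diff_distrib sum_subtractf)

lemma cinner_scale_left: "cinner (c *s x) y = c * cinner x y"
  by (simp add: cinner_def sum_distrib_left mult.assoc)

lemma cinner_scale_right: "cinner x (c *s y) = cnj c * cinner x y"
  by (simp add: cinner_def sum_distrib_left mult.left_commute)

lemma cinner_sum_left: "cinner (\<Sum>i\<in>S. f i) y = (\<Sum>i\<in>S. cinner (f i) y)"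
  by (induction S rule: infinite_finite_induct) (simp_all add: cinner_add_left, simp_all add: cinner_def)

lemma cnj_cinner: "cnj (cinner x y) = cinner y x"
  by (simp add: cinner_def mult.commute)

lemma cinner_sum_right: "cinner x (\<Sum>i\<in>S. f i) = (\<Sum>i\<in>S. cinner x (f i))"
  by (metis (mono_tags, lifting) cinner_sum_left cnj_cinner cnj_sum sum.cong)

lemma cinner_self_eq_0_iff: "cinner x x = 0 \<longleftrightarrow> x = 0"
  by (simp add: cinner_self)

lemma inner_eq_Re_cinner: "x \<bullet> y = Re (cinner x y)"
  by (simp add: inner_vec_def cinner_def inner_complex_def)

lemma cinner_adjoint: "cinner (A *v x) y = cinner x (conj_transpose A *v y)"
proof -
  have "cinner (A *v x) y = (\<Sum>i\<in>UNIV. \<Sum>j\<in>UNIV. A $ i $ j * x $ j * cnj (y $ i))"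
    by (simp add: cinner_def matrix_vector_mult_def sum_distrib_right)
  also have "\<dots> = (\<Sum>j\<in>UNIV. \<Sum>i\<in>UNIV. A $ i $ j * x $ j * cnj (y $ i))"
    by (rule sum.swap)
  also have "\<dots> = cinner x (conj_transpose A *v y)"
    by (simp add: cinner_def matrix_vector_mult_def conj_transpose_def sum_distrib_left ac_simps)
  finally show ?thesis .
qed

section \<open>Polynomials of a matrix applied to a vector\<close>

lemma mat_vector_mult: "mat c *v x = c *s x"
  by (simp add: vec_eq_iff mat_def matrix_vector_mult_def if_distrib[of "\<lambda>a. a * _"] cong: if_cong)

lemma sum_matrix_vector_mult: "(\<Sum>i\<in>S. f i) *v x = (\<Sum>i\<in>S. f i *v x)"
  by (induction S rule: infinite_finite_induct) (simp_all add: matrix_vector_mult_add_rdistrib)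

lemma matrix_vector_mult_sum: "A *v (\<Sum>i\<in>S. f i) = (\<Sum>i\<in>S. A *v f i)"
  by (induction S rule: infinite_finite_induct) (simp_all add: matrix_vector_right_distrib)

text \<open>Coefficients beyond the degree vanish. The free bound \<open>n\<close> allows
  polynomials of different degrees to be expanded over one common index range.\<close>

lemma poly_matrix_vector_mult:
  assumes "degree p \<le> n"
  shows "poly_matrix p A *v x = (\<Sum>k\<le>n. coeff p k *s (matrix_power A k *v x))"
proof -
  have "poly_matrix p A *v x = (\<Sum>k\<le>degree p. coeff p k *s (matrix_power A k *v x))"
    by (simp add: poly_matrix_def sum_matrix_vector_mult mat_vector_mult
        flip: matrix_vector_mul_assoc)
  also have "\<dots> = (\<Sum>k\<le>n. coeff p k *s (matrix_power A k *v x))"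
    by (rule sum.mono_neutral_left) (use assms in \<open>auto simp: coeff_eq_0\<close>)
  finally show ?thesis .
qed

text \<open>Multiplicativity of the polynomial calculus for a linear factor: multiplication by X
  shifts the coefficients, which amounts to one more application of \<open>A\<close>.\<close>

lemma poly_matrix_mult_linear_vector:
  "poly_matrix ([:- a, 1:] * q) A *v x = A *v (poly_matrix q A *v x) - a *s (poly_matrix q A *v x)"
proof -
  let ?n = "degree q"
  let ?P = "\<lambda>k. matrix_power A k *v x"
  have deg: "degree ([:- a, 1:] * q) \<le> Suc ?n"
    by (rule order_trans[OF degree_mult_le]) simp
  have split: "[:- a, 1:] * q = pCons 0 q - smult a q"
    by simp
  have "poly_matrix ([:- a, 1:] * q) A *v x
      = (\<Sum>k\<le>Suc ?n. coeff (pCons 0 q) k *s ?P k) - (\<Sum>k\<le>Suc ?n. (a * coeff q k) *s ?P k)"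
    unfolding poly_matrix_vector_mult[OF deg] unfolding split
    by (simp add: vec.scale_left_diff_distrib sum_subtractf del: sum.atMost_Suc)
  also have "(\<Sum>k\<le>Suc ?n. coeff (pCons 0 q) k *s ?P k) = (\<Sum>k\<le>?n. coeff q k *s ?P (Suc k))"
    by (subst sum.atMost_Suc_shift) simp
  also have "\<dots> = A *v (poly_matrix q A *v x)"
    by (simp add: poly_matrix_vector_mult[OF order_refl] matrix_vector_mult_sum
        vector_scalar_commute matrix_vector_mul_assoc)
  also have "(\<Sum>k\<le>Suc ?n. (a * coeff q k) *s ?P k) = a *s (poly_matrix q A *v x)"
    by (simp add: poly_matrix_vector_mult[of q "Suc ?n"] vec.scale_sum_right del: sum.atMost_Suc)
  finally show ?thesis .
qed

section \<open>Eigenvectors in invariant subspaces\<close>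

lemma annihilating_poly_exists:
  fixes A :: "complex ^ 'n ^ 'n"
  shows "\<exists>p. p \<noteq> 0 \<and> poly_matrix p A *v x = 0"
proof -
  define f where "f k = matrix_power A k *v x" for k
  define n where "n = CARD('n)"
  \<comment> \<open>The vectors x, Ax, ..., A^n x are n+1 vectors in an n-dimensional space. Linear
    dependence is a property of sets, so a repetition among them, which would shrink the set, is
    treated separately and gives the relation f i - f j = 0.\<close>
  have "\<exists>c. (\<exists>k\<le>n. c k \<noteq> 0) \<and> (\<Sum>k\<le>n. c k *s f k) = 0"
  proof (cases "inj_on f {..n}")
    case True
    have "vec.dependent (f ` {..n})"
    proof (rule ccontr)
      assume "vec.independent (f ` {..n})"
      then have "card (f ` {..n}) \<le> vec.dim (UNIV :: (complex ^ 'n) set)"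
        by (rule vec.independent_card_le_dim[OF subset_UNIV])
      then show False
        using card_image[OF True] unfolding vec_dim_card by (simp add: n_def)
    qed
    then obtain u v where "v \<in> f ` {..n}" "u v \<noteq> 0" "(\<Sum>v\<in>f ` {..n}. u v *s v) = 0"
      by (auto simp: vec.dependent_finite)
    then show ?thesis
      by (intro exI[of _ "u \<circ> f"]) (auto simp: sum.reindex[OF True])
  next
    case False
    then obtain i j where ij: "i \<le> n" "j \<le> n" "f i = f j" "i \<noteq> j"
      by (auto simp: inj_on_def)
    let ?c = "\<lambda>k. (if k = i then 1 else 0) - (if k = j then 1 else 0 :: complex)"
    have "(\<Sum>k\<le>n. ?c k *s f k) = f i - f j"
      using ij by (simp add: vec.scale_left_diff_distrib sum_subtractf
          if_distrib[of "\<lambda>a. a *s _"] cong: if_cong)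
    with ij show ?thesis
      by (intro exI[of _ ?c]) auto
  qed
  then obtain c k where c: "k \<le> n" "c k \<noteq> 0" "(\<Sum>k\<le>n. c k *s f k) = 0"
    by blast
  define p where "p = (\<Sum>k\<le>n. monom (c k) k)"
  have coeff_p: "coeff p j = (if j \<le> n then c j else 0)" for j
    by (simp add: p_def coeff_sum)
  have "degree p \<le> n"
    by (rule degree_le) (simp add: coeff_p)
  then have "poly_matrix p A *v x = 0"
    using c by (simp add: poly_matrix_vector_mult coeff_p f_def)
  moreover have "p \<noteq> 0"
    using c coeff_p[of k] by auto
  ultimately show ?thesis by blast
qed

text \<open>Let p be of least degree among the nonzero polynomials with p(A)x = 0, and split off a
  root: p = (X - a)q. By minimality q(A)x is nonzero, so it is an eigenvector for a; it lies in
  \<open>V\<close> as a combination of the vectors A^k x.\<close>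

lemma eigenvector_in_invariant_subspace:
  fixes A :: "complex ^ 'n ^ 'n"
  assumes V: "vec.subspace V" and inv: "\<And>y. y \<in> V \<Longrightarrow> A *v y \<in> V"
    and x: "x \<in> V" "x \<noteq> 0"
  shows "\<exists>v c. v \<in> V \<and> v \<noteq> 0 \<and> A *v v = c *s v"
proof -
  let ?P = "\<lambda>p. p \<noteq> 0 \<and> poly_matrix p A *v x = 0"
  obtain p0 where "?P p0"
    using annihilating_poly_exists[of A x] by (elim exE)
  then have "\<exists>p. ?P p \<and> (\<forall>q. ?P q \<longrightarrow> degree p \<le> degree q)"
    by (rule ex_has_least_nat)
  then obtain p where p: "?P p" and min: "\<And>q. ?P q \<Longrightarrow> degree p \<le> degree q"
    by (elim exE conjE) simp
  have "degree p \<noteq> 0"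
  proof
    assume "degree p = 0"
    then have "poly_matrix p A *v x = coeff p 0 *s x" "coeff p 0 \<noteq> 0"
      using p by (simp_all add: poly_matrix_vector_mult[of p 0]) (metis leading_coeff_0_iff)
    with p x show False by simp
  qed
  then obtain a where "poly p a = 0"
    using fundamental_theorem_of_algebra[of p] by (auto simp: constant_degree)
  then obtain q where q: "p = [:- a, 1:] * q"
    by (metis dvdE poly_eq_0_iff_dvd)
  with p have "q \<noteq> 0" by auto
  then have "degree q < degree p"
    unfolding q by (subst degree_mult_eq) auto
  with min \<open>q \<noteq> 0\<close> have "poly_matrix q A *v x \<noteq> 0"
    by fastforce
  moreover have "A *v (poly_matrix q A *v x) = a *s (poly_matrix q A *v x)"
    using p poly_matrix_mult_linear_vector[of a q A x] q by simp
  moreover have "matrix_power A k *v x \<in> V" for k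
    by (induction k) (simp_all add: x inv flip: matrix_vector_mul_assoc)
  then have "poly_matrix q A *v x \<in> V"
    by (simp add: poly_matrix_vector_mult[OF order_refl] vec.subspace_sum vec.subspace_scale V)
  ultimately show ?thesis by blast
qed

section \<open>The spectral theorem for normal matrices\<close>

lemma normal_matrix_eigenvector_adjoint:
  assumes "normal_matrix N" and u: "N *v u = c *s u"
  shows "conj_transpose N *v u = cnj c *s u"
proof -
  let ?M = "conj_transpose N"
  have M: "cinner (?M *v x) y = cinner x (N *v y)" for x y
    by (metis cinner_adjoint cnj_cinner)
  \<comment> \<open>Normality enters here: N*u and Nu have equal norms. Hence the four terms in the
    expansion of the squared norm of N*u - cnj(c)u all equal |c|^2 <u,u> up to sign, and they
    cancel.\<close>
  have "cinner (?M *v u) (?M *v u) = cinner (N *v u) (N *v u)"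
    using assms(1) unfolding normal_matrix_def
    by (metis M cinner_adjoint matrix_vector_mul_assoc)
  then have "cinner (?M *v u) (?M *v u) = c * (cnj c * cinner u u)"
    by (simp add: u cinner_scale_left cinner_scale_right)
  moreover have "cinner (?M *v u) u = cnj c * cinner u u" "cinner u (?M *v u) = c * cinner u u"
    by (simp_all add: M u cinner_scale_left cinner_scale_right flip: cinner_adjoint)
  ultimately have "cinner (?M *v u - cnj c *s u) (?M *v u - cnj c *s u) = 0"
    by (simp add: cinner_diff_left cinner_diff_right cinner_scale_left cinner_scale_right)
  then show ?thesis
    by (simp add: cinner_self_eq_0_iff)
qed

definition orthonormal_eigenvectors :: "complex ^ 'n ^ 'n \<Rightarrow> (complex ^ 'n) set \<Rightarrow> bool" where
  "orthonormal_eigenvectors N S \<longleftrightarrow>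
     (\<forall>u\<in>S. \<forall>v\<in>S. cinner u v = (if u = v then 1 else 0)) \<and> (\<forall>u\<in>S. \<exists>c. N *v u = c *s u)"

text \<open>This serves to bound the cardinality of \<open>S\<close>. Any finite bound will do, so
  independence over the reals suffices, with the real part of \<open>cinner\<close> as inner
  product.\<close>

lemma orthonormal_eigenvectors_independent:
  assumes "orthonormal_eigenvectors N S"
  shows "independent S"
proof (rule pairwise_orthogonal_independent)
  show "pairwise orthogonal S"
    using assms by (auto simp: pairwise_def orthogonal_def inner_eq_Re_cinner
        orthonormal_eigenvectors_def)
  show "0 \<notin> S"
    using assms cinner_self_eq_0_iff unfolding orthonormal_eigenvectors_def by (metis zero_neq_one)
qed

text \<open>The orthogonal complement of \<open>S\<close> is invariant under \<open>N\<close>,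
  because each u in \<open>S\<close> is also an eigenvector of the adjoint: <Ny,u> = <y,N*u> =
  c<y,u> = 0. It contains x, hence an eigenvector of \<open>N\<close>, which is then
  normalized.\<close>

lemma orthonormal_eigenvectors_extend:
  assumes N: "normal_matrix N" and S: "orthonormal_eigenvectors N S"
    and x: "x \<noteq> 0" "\<And>u. u \<in> S \<Longrightarrow> cinner x u = 0"
  shows "\<exists>v. v \<notin> S \<and> orthonormal_eigenvectors N (insert v S)"
proof -
  define V where "V = {y. \<forall>u\<in>S. cinner y u = 0}"
  have "vec.subspace V"
    by (auto simp: V_def vec.subspace_def cinner_add_left cinner_scale_left) (simp add: cinner_def)
  moreover have "N *v y \<in> V" if "y \<in> V" for y
    unfolding V_def
  proof (intro CollectI ballI)
    fix u assume "u \<in> S"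
    with S obtain c where "N *v u = c *s u"
      unfolding orthonormal_eigenvectors_def by blast
    then show "cinner (N *v y) u = 0"
      using that \<open>u \<in> S\<close> normal_matrix_eigenvector_adjoint[OF N, of u c]
      by (simp add: cinner_adjoint cinner_scale_right V_def)
  qed
  moreover have "x \<in> V"
    using x by (simp add: V_def)
  ultimately obtain v c where v: "v \<in> V" "v \<noteq> 0" "N *v v = c *s v"
    using eigenvector_in_invariant_subspace[of V N x] x by blast
  define w where "w = of_real (1 / norm v) *s v"
  have w1: "cinner w w = 1"
    using v by (simp add: w_def cinner_scale_left cinner_scale_right cinner_self[of v] power2_eq_square)
  have w0: "cinner w u = 0" "cinner u w = 0" if "u \<in> S" for u
    using v that cnj_cinner[of v u]
    by (simp_all add: w_def cinner_scale_left cinner_scale_right V_def)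
  have Nw: "N *v w = c *s w"
    using v by (simp add: w_def vector_scalar_commute vec.scale_left_commute)
  have "w \<notin> S"
    using w0(1)[of w] w1 by auto
  have orth: "cinner u u' = (if u = u' then 1 else 0)"
    if "u \<in> insert w S" "u' \<in> insert w S" for u u'
  proof (cases "u = w \<or> u' = w")
    case True
    with that w0 w1 \<open>w \<notin> S\<close> show ?thesis by auto
  next
    case False
    with that S show ?thesis by (simp add: orthonormal_eigenvectors_def)
  qed
  have eigen: "\<exists>a. N *v u = a *s u" if "u \<in> insert w S" for u
  proof (cases "u = w")
    case True
    with Nw show ?thesis by blast
  next
    case False
    with that S show ?thesis by (simp add: orthonormal_eigenvectors_def)
  qed
  have "orthonormal_eigenvectors N (insert w S)"
    unfolding orthonormal_eigenvectors_def by (intro conjI ballI orth eigen)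
  with \<open>w \<notin> S\<close> show ?thesis by blast
qed

text \<open>Choose \<open>S\<close> of largest cardinality. If some x differed from its expansion,
  the remainder would be nonzero and orthogonal to \<open>S\<close>, so \<open>S\<close> could be
  enlarged.\<close>

lemma normal_matrix_spectral:
  fixes N :: "complex ^ 'n ^ 'n"
  assumes N: "normal_matrix N"
  obtains S where "finite S" "orthonormal_eigenvectors N S"
    "\<forall>x. x = (\<Sum>u\<in>S. cinner x u *s u)"
proof -
  have "orthonormal_eigenvectors N {}"
    by (simp add: orthonormal_eigenvectors_def)
  moreover have "\<forall>T. orthonormal_eigenvectors N T \<longrightarrow> card T < Suc DIM(complex ^ 'n)"
    by (auto simp: less_Suc_eq_le dest!: orthonormal_eigenvectors_independent independent_bound)
  ultimately have "\<exists>S. orthonormal_eigenvectors N S \<and>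
      (\<forall>T. orthonormal_eigenvectors N T \<longrightarrow> card T \<le> card S)"
    by (rule ex_has_greatest_nat)
  then obtain S where S: "orthonormal_eigenvectors N S"
    and max: "\<And>T. orthonormal_eigenvectors N T \<Longrightarrow> card T \<le> card S"
    by blast
  have fin: "finite S"
    using independent_bound[OF orthonormal_eigenvectors_independent[OF S]] by simp
  have "x = (\<Sum>u\<in>S. cinner x u *s u)" for x
  proof (rule ccontr)
    let ?y = "x - (\<Sum>u\<in>S. cinner x u *s u)"
    assume "\<not> ?thesis"
    then have "?y \<noteq> 0" by simp
    moreover have "cinner ?y v = 0" if "v \<in> S" for v
    proof -
      have "(\<Sum>u\<in>S. cinner x u * cinner u v) = (\<Sum>u\<in>S. if u = v then cinner x u else 0)"
        using S that by (intro sum.cong) (auto simp: orthonormal_eigenvectors_def)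
      then show ?thesis
        using that fin by (simp add: cinner_diff_left cinner_sum_left cinner_scale_left)
    qed
    ultimately obtain v where "v \<notin> S" "orthonormal_eigenvectors N (insert v S)"
      using orthonormal_eigenvectors_extend[OF N S] by blast
    with max[of "insert v S"] fin show False by simp
  qed
  then show thesis
    by (intro that[OF fin S] allI)
qed

section \<open>Crouzeix's bound for orthogonal sums of scalar multiples\<close>

text \<open>The embeddings \<open>V u\<close> are kept abstract so that both orders of the tensor
  factors are instances.\<close>

lemma satisfies_crouzeix_orthogonal_sum:
  fixes A :: "complex ^ 'n ^ 'n" and B :: "complex ^ 'k ^ 'k"
    and V :: "'i \<Rightarrow> complex ^ 'n \<Rightarrow> complex ^ 'k"
  assumes A: "satisfies_crouzeix A" and fin: "finite S"
    and add: "\<And>u x y. u \<in> S \<Longrightarrow> V u (x + y) = V u x + V u y"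
    and scale: "\<And>u c x. u \<in> S \<Longrightarrow> V u (c *s x) = c *s V u x"
    and orth: "\<And>u v x y. u \<in> S \<Longrightarrow> v \<in> S \<Longrightarrow>
      cinner (V u x) (V v y) = (if u = v then cinner x y else 0)"
    and B: "\<And>u x. u \<in> S \<Longrightarrow> B *v V u x = c u *s V u (A *v x)"
    and span: "\<And>x. \<exists>y. x = (\<Sum>u\<in>S. V u (y u))"
  shows "satisfies_crouzeix B"
  unfolding satisfies_crouzeix_def
proof
  fix p :: "complex poly"
  define M where "M = 2 * (SUP z\<in>numerical_range B. cmod (poly p z))"
  define q where "q u = pcompose p [:0, c u:]" for u
  have V_sum: "V u (\<Sum>i\<in>I. f i) = (\<Sum>i\<in>I. V u (f i))" if "u \<in> S" for u I and f :: "nat \<Rightarrow> _"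
    \<comment> \<open>Scaling by 0 gives \<open>V u 0 = 0\<close>, which settles empty and infinite
      index sets.\<close>
    using add[OF that] scale[OF that, of 0 0]
    by (induction I rule: infinite_finite_induct) auto
  have pow: "matrix_power B k *v V u x = c u ^ k *s V u (matrix_power A k *v x)"
    if "u \<in> S" for u k x
    by (induction k) (simp_all add: B that vector_scalar_commute flip: matrix_vector_mul_assoc)
  have p_V: "poly_matrix p B *v V u x = V u (poly_matrix (q u) A *v x)" if u: "u \<in> S" for u x
  proof -
    \<comment> \<open>The degree drops when \<open>c u = 0\<close>, so both polynomials are expanded
      up to \<open>degree p\<close>; the k-th coefficient of \<open>q u\<close> is that of
      \<open>p\<close> times \<open>c u ^ k\<close>.\<close>
    have "degree (q u) \<le> degree p"
      unfolding q_def by (rule order_trans[OF degree_pcompose_le]) simp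
    then show ?thesis
      by (simp add: poly_matrix_vector_mult[of _ "degree p"] V_sum u scale pow q_def
          coeff_pcompose_linear mult.commute)
  qed
  \<comment> \<open>\<open>V u\<close> maps a unit vector x to a unit vector, at which the quadratic
    form of \<open>B\<close> takes \<open>c u\<close> times the value of that of \<open>A\<close> at
    x.\<close>
  have W: "c u * z \<in> numerical_range B" if u: "u \<in> S" and "z \<in> numerical_range A" for u z
  proof -
    obtain x where "cinner x x = 1" "z = cinner (A *v x) x"
      using \<open>z \<in> numerical_range A\<close> by (auto simp: numerical_range_def)
    then show ?thesis
      unfolding numerical_range_def
      by (intro CollectI exI[of _ "V u x"]) (simp add: B orth u cinner_scale_left)
  qed
  \<comment> \<open>The values of \<open>q u\<close> on W(A) are values of \<open>p\<close> on W(B),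
    so the supremum in the bound for \<open>A\<close> is at most M / 2.\<close>
  have bound: "norm (poly_matrix (q u) A *v y) \<le> M * norm y" if u: "u \<in> S" for u y
  proof -
    have "matrix_opnorm (poly_matrix (q u) A) \<le> 2 * (SUP z\<in>numerical_range A. cmod (poly (q u) z))"
      using A by (simp add: satisfies_crouzeix_def)
    also have "(SUP z\<in>numerical_range A. cmod (poly (q u) z)) \<le> M / 2"
    proof (rule cSUP_least[OF numerical_range_nonempty])
      fix z assume "z \<in> numerical_range A"
      from W[OF u this] show "cmod (poly (q u) z) \<le> M / 2"
        by (simp add: q_def poly_pcompose M_def mult.commute)
          (metis bdd_above_poly_numerical_range cSUP_upper)
    qed
    finally have "matrix_opnorm (poly_matrix (q u) A) \<le> M" by simp
    moreover have "norm (poly_matrix (q u) A *v y) \<le> matrix_opnorm (poly_matrix (q u) A) * norm y"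
      unfolding matrix_opnorm_def by (rule onorm) simp
    ultimately show ?thesis
      by (meson mult_right_mono norm_ge_zero order_trans)
  qed
  \<comment> \<open>Needed to pass from squared norms back to norms at the end.\<close>
  have "0 \<le> M"
  proof -
    obtain z where "z \<in> numerical_range B"
      using numerical_range_nonempty by blast
    then have "cmod (poly p z) \<le> M / 2"
      unfolding M_def using cSUP_upper[OF _ bdd_above_poly_numerical_range] by simp
    then show ?thesis
      using norm_ge_zero[of "poly p z"] by linarith
  qed
  have pythagoras: "(norm (\<Sum>u\<in>S. V u (y u)))\<^sup>2 = (\<Sum>u\<in>S. (norm (y u))\<^sup>2)" for y
  proof -
    have "complex_of_real ((norm (\<Sum>u\<in>S. V u (y u)))\<^sup>2)
        = (\<Sum>u\<in>S. \<Sum>v\<in>S. if u = v then cinner (y u) (y v) else 0)"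
      unfolding cinner_self[symmetric] cinner_sum_left cinner_sum_right
      by (rule sum.swap[THEN trans], intro sum.cong) (auto simp: orth)
    also have "\<dots> = of_real (\<Sum>u\<in>S. (norm (y u))\<^sup>2)"
      using fin by (simp add: cinner_self)
    finally show ?thesis
      using of_real_eq_iff by blast
  qed
  \<comment> \<open>p(B) maps each block into itself, so the blockwise bounds add up by the
    Pythagorean identity.\<close>
  have "norm (poly_matrix p B *v x) \<le> M * norm x" for x
  proof (rule power2_le_imp_le)
    obtain y where x: "x = (\<Sum>u\<in>S. V u (y u))"
      using span by blast
    have "(norm (poly_matrix p B *v x))\<^sup>2 = (\<Sum>u\<in>S. (norm (poly_matrix (q u) A *v y u))\<^sup>2)"
      by (simp add: x matrix_vector_mult_sum p_V pythagoras)
    also have "\<dots> \<le> (\<Sum>u\<in>S. (M * norm (y u))\<^sup>2)"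
      by (intro sum_mono power_mono bound norm_ge_zero)
    also have "\<dots> = (M * norm x)\<^sup>2"
      by (simp add: x power_mult_distrib pythagoras sum_distrib_left)
    finally show "(norm (poly_matrix p B *v x))\<^sup>2 \<le> (M * norm x)\<^sup>2" .
    show "0 \<le> M * norm x"
      using \<open>0 \<le> M\<close> by simp
  qed
  then show "matrix_opnorm (poly_matrix p B) \<le> 2 * (SUP z\<in>numerical_range B. cmod (poly p z))"
    unfolding matrix_opnorm_def M_def by (rule onorm_le)
qed

section \<open>Elementary tensors and the Kronecker product\<close>

definition vec_tensor :: "complex ^ 'm \<Rightarrow> complex ^ 'n \<Rightarrow> complex ^ ('m \<times> 'n)" where
  "vec_tensor x y = (\<chi> i. x $ fst i * y $ snd i)"

lemma sum_UNIV_prod: "(\<Sum>i\<in>UNIV. f i) = (\<Sum>a\<in>UNIV. \<Sum>b\<in>UNIV. f (a, b))"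
  by (simp add: sum.cartesian_product flip: UNIV_Times_UNIV)

lemma cinner_vec_tensor: "cinner (vec_tensor x y) (vec_tensor x' y') = cinner x x' * cinner y y'"
  by (simp add: cinner_def vec_tensor_def sum_UNIV_prod sum_product ac_simps)

lemma kronecker_vec_tensor: "(A \<otimes>\<^sub>K B) *v vec_tensor x y = vec_tensor (A *v x) (B *v y)"
  by (simp add: vec_eq_iff kronecker_def matrix_vector_mult_def vec_tensor_def sum_UNIV_prod
      sum_product ac_simps)

lemma vec_tensor_add_left: "vec_tensor (x + y) z = vec_tensor x z + vec_tensor y z"
  by (simp add: vec_eq_iff vec_tensor_def distrib_right)

lemma vec_tensor_add_right: "vec_tensor x (y + z) = vec_tensor x y + vec_tensor x z"
  by (simp add: vec_eq_iff vec_tensor_def distrib_left)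

lemma vec_tensor_scale_left: "vec_tensor (c *s x) y = c *s vec_tensor x y"
  by (simp add: vec_eq_iff vec_tensor_def)

lemma vec_tensor_scale_right: "vec_tensor x (c *s y) = c *s vec_tensor x y"
  by (simp add: vec_eq_iff vec_tensor_def)

theorem proposition2p6:
  fixes A :: "complex ^ 'n ^ 'n" and N :: "complex ^ 'm ^ 'm"
  assumes "satisfies_crouzeix A"
    and "normal_matrix N"
  shows "satisfies_crouzeix (N \<otimes>\<^sub>K A) \<and> satisfies_crouzeix (A \<otimes>\<^sub>K N)"
proof -
  obtain S where fin: "finite S" and S: "orthonormal_eigenvectors N S"
    and expand: "\<forall>x. x = (\<Sum>u\<in>S. cinner x u *s u)"
    using normal_matrix_spectral[OF assms(2)] .
  have orth: "cinner u v = (if u = v then 1 else 0)" if "u \<in> S" "v \<in> S" for u v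
    using S that by (simp add: orthonormal_eigenvectors_def)
  obtain c where c: "\<And>u. u \<in> S \<Longrightarrow> N *v u = c u *s u"
    using S unfolding orthonormal_eigenvectors_def by metis
  have comp: "x $ i = (\<Sum>u\<in>S. cinner x u * u $ i)" for x i
    using arg_cong[OF expand[rule_format, of x], of "\<lambda>v. v $ i"] by simp
  have "satisfies_crouzeix (N \<otimes>\<^sub>K A)"
  proof (rule satisfies_crouzeix_orthogonal_sum[OF assms(1) fin, where V = vec_tensor and c = c])
    fix x :: "complex ^ ('m \<times> 'n)"
    show "\<exists>y. x = (\<Sum>u\<in>S. vec_tensor u (y u))"
    proof (intro exI)
      \<comment> \<open>View x as an m by n array and expand each column x(., j) in the eigenbasis;
        entry j of the vector paired with u is the coefficient of u in that column.\<close>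
      show "x = (\<Sum>u\<in>S. vec_tensor u (\<chi> j. cinner (\<chi> i. x $ (i, j)) u))"
        unfolding vec_eq_iff
      proof
        fix k
        show "x $ k = (\<Sum>u\<in>S. vec_tensor u (\<chi> j. cinner (\<chi> i. x $ (i, j)) u)) $ k"
          using comp[of "\<chi> i. x $ (i, snd k)" "fst k"] by (simp add: vec_tensor_def mult.commute)
      qed
    qed
  qed (simp_all add: vec_tensor_add_right vec_tensor_scale_right cinner_vec_tensor orth
      kronecker_vec_tensor c vec_tensor_scale_left)
  moreover have "satisfies_crouzeix (A \<otimes>\<^sub>K N)"
  proof (rule satisfies_crouzeix_orthogonal_sum[OF assms(1) fin,
        where V = "\<lambda>u y. vec_tensor y u" and c = c])
    fix x :: "complex ^ ('n \<times> 'm)"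
    show "\<exists>y. x = (\<Sum>u\<in>S. vec_tensor (y u) u)"
    proof (intro exI)
      \<comment> \<open>Here x is an n by m array, and its rows x(j, .) are expanded
        instead.\<close>
      show "x = (\<Sum>u\<in>S. vec_tensor (\<chi> j. cinner (\<chi> i. x $ (j, i)) u) u)"
        unfolding vec_eq_iff
      proof
        fix k
        show "x $ k = (\<Sum>u\<in>S. vec_tensor (\<chi> j. cinner (\<chi> i. x $ (j, i)) u) u) $ k"
          using comp[of "\<chi> i. x $ (fst k, i)" "snd k"] by (simp add: vec_tensor_def)
      qed
    qed
  qed (simp_all add: vec_tensor_add_left vec_tensor_scale_left cinner_vec_tensor orth
      kronecker_vec_tensor c vec_tensor_scale_right)
  ultimately show ?thesis by blast
qed

end
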